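(* Let $S$ be a distributive PN-semiring. Then the following statements are equivalent: (1) The PN-semiring $S$ is eversible. (2) For any $a,b\in S$, if $ab=0$ then one of the following occurs: (a) there exists $c\in S\setminus\{0\}$ such that $bc=0=ca$; (b) there exists $c\in S\setminus\{0\}$ such that $bc\neq 0$, $ca\neq 0$, and $bca=0$.
   Context: A distributive PN-semiring (prenearsemiring) is an algebra $(S,+,\cdot,0,1)$ of type $(2,2,0,0)$ such that: $(S,+,0)$ is a unital magma (a set with a binary operation, not assumed associative or commutative, with neutral element $0$); $(S,\cdot,1)$ is a monoid; $(u+v)w=uw+vw$ and $u(v+w)=uv+uw$ for all $u,v,w\in S$; and $s0=0s=0$ for all $s\in S$. An element $s\in S$ is a left (resp. right) zero-divisor if there is a nonzero $x\in S$ with $sx=0$ (resp. $xs=0$). $S$ is eversible if $(S,\cdot,0)$ is an eversible semigroup with zero (a semigroup with zero has at least two elements), i.e. every left zero-divisor of $S$ is a right zero-divisor of $S$ and conversely.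
   Formalization: In (2), a and b range over nonzero elements of S, since with a=1, b=0 condition (2) as printed fails in every S, even in an eversible field; S is also assumed to be different from {0}. *)

theory Defs
  imports "HOL-Algebra.Ring"
begin

text \<open>
  The algebra \<open>(S,+,\<cdot>,0,1)\<close> is carried by the ring record of HOL-Algebra. Only the
  multiplicative monoid is inherited from the library: addition is merely a unital magma, with
  neither associativity nor commutativity, so \<open>semiring\<close> is not available here.
\<close>

locale distributive_pn_semiring = monoid S for S (structure) +
  assumes add_closed: "\<lbrakk>x \<in> carrier S; y \<in> carrier S\<rbrakk> \<Longrightarrow> x \<oplus> y \<in> carrier S"
    and zero_closed: "\<zero> \<in> carrier S"
    and add_zero_left: "x \<in> carrier S \<Longrightarrow> \<zero> \<oplus> x = x"
    and add_zero_right: "x \<in> carrier S \<Longrightarrow> x \<oplus> \<zero> = x"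
    and distrib_right: "\<lbrakk>u \<in> carrier S; v \<in> carrier S; w \<in> carrier S\<rbrakk>
          \<Longrightarrow> (u \<oplus> v) \<otimes> w = u \<otimes> w \<oplus> v \<otimes> w"
    and distrib_left: "\<lbrakk>u \<in> carrier S; v \<in> carrier S; w \<in> carrier S\<rbrakk>
          \<Longrightarrow> u \<otimes> (v \<oplus> w) = u \<otimes> v \<oplus> u \<otimes> w"
    and mult_zero_right: "s \<in> carrier S \<Longrightarrow> s \<otimes> \<zero> = \<zero>"
    and mult_zero_left: "s \<in> carrier S \<Longrightarrow> \<zero> \<otimes> s = \<zero>"

text \<open>
  The reduct \<open>(S,\<cdot>,0)\<close>. By convention a semigroup with zero has at least two elements.
\<close>

locale semigroup_with_zero =
  fixes S (structure)
  assumes mult_closed: "\<lbrakk>x \<in> carrier S; y \<in> carrier S\<rbrakk> \<Longrightarrow> x \<otimes> y \<in> carrier S"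
    and mult_assoc: "\<lbrakk>x \<in> carrier S; y \<in> carrier S; z \<in> carrier S\<rbrakk>
          \<Longrightarrow> (x \<otimes> y) \<otimes> z = x \<otimes> (y \<otimes> z)"
    and zero_in_carrier: "\<zero> \<in> carrier S"
    and zero_left: "x \<in> carrier S \<Longrightarrow> \<zero> \<otimes> x = \<zero>"
    and zero_right: "x \<in> carrier S \<Longrightarrow> x \<otimes> \<zero> = \<zero>"
    and two_elements: "\<exists>x \<in> carrier S. \<exists>y \<in> carrier S. x \<noteq> y"

text \<open>Zero itself counts as a zero-divisor as soon as there is a nonzero element.\<close>

definition left_zero_divisor :: "('a, 'm) ring_scheme \<Rightarrow> 'a \<Rightarrow> bool" where
  "left_zero_divisor S s \<longleftrightarrow>
     s \<in> carrier S \<and> (\<exists>x \<in> carrier S - {\<zero>\<^bsub>S\<^esub>}. s \<otimes>\<^bsub>S\<^esub> x = \<zero>\<^bsub>S\<^esub>)"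

definition right_zero_divisor :: "('a, 'm) ring_scheme \<Rightarrow> 'a \<Rightarrow> bool" where
  "right_zero_divisor S s \<longleftrightarrow>
     s \<in> carrier S \<and> (\<exists>x \<in> carrier S - {\<zero>\<^bsub>S\<^esub>}. x \<otimes>\<^bsub>S\<^esub> s = \<zero>\<^bsub>S\<^esub>)"

definition eversible :: "('a, 'm) ring_scheme \<Rightarrow> bool" where
  "eversible S \<longleftrightarrow>
     semigroup_with_zero S \<and>
     (\<forall>s \<in> carrier S. left_zero_divisor S s \<longleftrightarrow> right_zero_divisor S s)"

end

theory Submission
  imports Defs
begin

text \<open>
  Suppose \<open>ab = 0\<close> with \<open>xa = 0\<close> and \<open>by = 0\<close>, all nonzero. If \<open>bx = 0\<close> or \<open>ya = 0\<close>, then \<open>x\<close> or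
  \<open>y\<close> is a witness for (a). Otherwise \<open>c = x + y\<close> satisfies \<open>bc = bx \<noteq> 0\<close>, \<open>ca = ya \<noteq> 0\<close> and
  \<open>bca = (bx)a = b(xa) = 0\<close>. Conversely, a zero \<open>bca = 0\<close> with \<open>bc\<close> and \<open>ca\<close> nonzero
  makes \<open>a\<close> a right and \<open>b\<close> a left zero-divisor.
\<close>

theorem theorem3p4:
  fixes S :: "('a, 'm) ring_scheme" (structure)
  assumes "distributive_pn_semiring S"
    and nontrivial: "carrier S \<noteq> {\<zero>}"
  shows "eversible S \<longleftrightarrow>
    (\<forall>a \<in> carrier S - {\<zero>}. \<forall>b \<in> carrier S - {\<zero>}. a \<otimes> b = \<zero> \<longrightarrow>
        (\<exists>c \<in> carrier S - {\<zero>}. b \<otimes> c = \<zero> \<and> c \<otimes> a = \<zero>) \<or>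
        (\<exists>c \<in> carrier S - {\<zero>}.
            b \<otimes> c \<noteq> \<zero> \<and> c \<otimes> a \<noteq> \<zero> \<and> b \<otimes> c \<otimes> a = \<zero>))"
    (is "_ \<longleftrightarrow> ?R")
proof -
  interpret distributive_pn_semiring S by fact
  note [simp] = zero_closed mult_zero_left mult_zero_right
  obtain e where e: "e \<in> carrier S" "e \<noteq> \<zero>"
    using nontrivial zero_closed by blast
  have zd0: "left_zero_divisor S \<zero>" "right_zero_divisor S \<zero>"
    using e by (auto simp: left_zero_divisor_def right_zero_divisor_def)
  have sz: "semigroup_with_zero S"
  proof
    show "\<exists>x \<in> carrier S. \<exists>y \<in> carrier S. x \<noteq> y"
      using e zero_closed by blast
  qed (auto simp: m_assoc)
  show ?thesis
  proof
    assume ev: "eversible S"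
    show ?R
    proof (intro ballI impI)
      fix a b
      assume "a \<in> carrier S - {\<zero>}" "b \<in> carrier S - {\<zero>}" and ab: "a \<otimes> b = \<zero>"
      then have a: "a \<in> carrier S" "a \<noteq> \<zero>" and b: "b \<in> carrier S" "b \<noteq> \<zero>"
        by auto
      have "left_zero_divisor S a" "right_zero_divisor S b"
        using a b ab by (auto simp: left_zero_divisor_def right_zero_divisor_def)
      then have "right_zero_divisor S a" "left_zero_divisor S b"
        using ev a b by (auto simp: eversible_def)
      then obtain x y where x: "x \<in> carrier S" "x \<noteq> \<zero>" "x \<otimes> a = \<zero>"
        and y: "y \<in> carrier S" "y \<noteq> \<zero>" "b \<otimes> y = \<zero>"
        by (auto simp: left_zero_divisor_def right_zero_divisor_def)
      consider "b \<otimes> x = \<zero>" | "y \<otimes> a = \<zero>" | "b \<otimes> x \<noteq> \<zero>" "y \<otimes> a \<noteq> \<zero>"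
        by blast
      then show "(\<exists>c \<in> carrier S - {\<zero>}. b \<otimes> c = \<zero> \<and> c \<otimes> a = \<zero>) \<or>
        (\<exists>c \<in> carrier S - {\<zero>}. b \<otimes> c \<noteq> \<zero> \<and> c \<otimes> a \<noteq> \<zero> \<and> b \<otimes> c \<otimes> a = \<zero>)"
      proof cases
        case 1
        then show ?thesis using x by blast
      next
        case 2
        then show ?thesis using y by blast
      next
        case 3
        have bc: "b \<otimes> (x \<oplus> y) = b \<otimes> x"
          using b x y by (simp add: distrib_left add_zero_right)
        have ca: "(x \<oplus> y) \<otimes> a = y \<otimes> a"
          using a x y by (simp add: distrib_right add_zero_left)
        have "b \<otimes> (x \<oplus> y) \<otimes> a = \<zero>"
          using a b x by (simp add: bc m_assoc)
        moreover have "x \<oplus> y \<in> carrier S - {\<zero>}"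
          using 3 a b x y bc by (auto simp: add_closed)
        moreover have "b \<otimes> (x \<oplus> y) \<noteq> \<zero>" "(x \<oplus> y) \<otimes> a \<noteq> \<zero>"
          using 3 bc ca by simp_all
        ultimately show ?thesis
          by blast
      qed
    qed
  next
    assume R: ?R
    have "left_zero_divisor S s \<longleftrightarrow> right_zero_divisor S s" if s: "s \<in> carrier S" for s
    proof (cases "s = \<zero>")
      case True
      then show ?thesis using zd0 by simp
    next
      case False
      show ?thesis
      proof
        assume "left_zero_divisor S s"
        then obtain x where x: "x \<in> carrier S - {\<zero>}" "s \<otimes> x = \<zero>"
          by (auto simp: left_zero_divisor_def)
        then obtain c where c: "c \<in> carrier S - {\<zero>}"
          and "c \<otimes> s = \<zero> \<or> x \<otimes> c \<noteq> \<zero> \<and> x \<otimes> c \<otimes> s = \<zero>"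
          using R s False by blast
        moreover have "x \<otimes> c \<in> carrier S" using x c by auto
        ultimately show "right_zero_divisor S s"
          using s by (auto simp: right_zero_divisor_def)
      next
        assume "right_zero_divisor S s"
        then obtain x where x: "x \<in> carrier S - {\<zero>}" "x \<otimes> s = \<zero>"
          by (auto simp: right_zero_divisor_def)
        then obtain c where c: "c \<in> carrier S - {\<zero>}"
          and "s \<otimes> c = \<zero> \<or> c \<otimes> x \<noteq> \<zero> \<and> s \<otimes> c \<otimes> x = \<zero>"
          using R s False by blast
        moreover have "c \<otimes> x \<in> carrier S" "s \<otimes> c \<otimes> x = s \<otimes> (c \<otimes> x)"
          using x c s by (auto simp: m_assoc)
        ultimately show "left_zero_divisor S s"
          using s by (auto simp: left_zero_divisor_def)
      qed
    qed
    then show "eversible S"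
      using sz by (simp add: eversible_def)
  qed
qed

end
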